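(* The generating function $f_1(q,t)$ for the $q$-Catalan numbers satisfies $$f_1(q,t) = \frac{q\left(f_0\left(q,\frac{t}{q}\right)-1\right)}{t\, f_0\left(q,\frac{t}{q}\right)},$$ where $f_0(q,t)=\frac{(qt;q^2)_\infty}{(t;q^2)_\infty}$.
   Context: $(a;q)_0=1$, $(a;q)_n=\prod_{k=0}^{n-1}(1-aq^k)$ for $n\ge 1$, and $(a;q)_\infty=\prod_{k\ge 0}(1-aq^k)$. $[i]_q=\frac{1-q^i}{1-q}$ and $[k]_q!=\prod_{i=1}^k [i]_q$. The $q$-super Catalan numbers are, for nonnegative integers $n,m$, $T_{n,m}(q)=\frac{[2m]_q!\,[2n]_q!}{[m]_q!\,[n]_q!\,[m+n]_q!}$; $T_{n,1}(q)=(1+q)C_n(q)$ where $C_n(q)=\frac{1}{[n+1]_q}\frac{[2n]_q!}{[n]_q!^2}$ is the $q$-Catalan number. For a nonnegative integer $m$, the generating function $f_m$ is defined by $$f_m(q,t)=\frac{1}{(-q;q)_m}\sum_{n=0}^\infty \frac{T_{n,m}(q)}{(-q;q)_n(-q;q)_{n+m}}t^n .$$ For $m=0$, this series $f_0(q,t)$ equals the infinite product given in the claim. Identities are between formal power series in $t$ whose coefficients are regarded as formal Laurent series in $q$. *)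

theory Defs
  imports "HOL-Computational_Algebra.Computational_Algebra"
begin

definition qpoch :: "'b::comm_ring_1 \<Rightarrow> 'b \<Rightarrow> nat \<Rightarrow> 'b" where
  "qpoch a q n = (\<Prod>k<n. 1 - a * q ^ k)"

definition qint :: "'b::field \<Rightarrow> nat \<Rightarrow> 'b" where
  "qint q i = (1 - q ^ i) / (1 - q)"

definition qfact :: "'b::field \<Rightarrow> nat \<Rightarrow> 'b" where
  "qfact q k = (\<Prod>i=1..k. qint q i)"

definition q_super_catalan :: "'b::field \<Rightarrow> nat \<Rightarrow> nat \<Rightarrow> 'b" where
  "q_super_catalan q n m =
     (qfact q (2 * m) * qfact q (2 * n)) / (qfact q m * qfact q n * qfact q (m + n))"

definition qsc_gf :: "nat \<Rightarrow> 'b::field \<Rightarrow> 'b fps" where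
  "qsc_gf m q = fps_const (1 / qpoch (- q) q m) *
     Abs_fps (\<lambda>n. q_super_catalan q n m / (qpoch (- q) q n * qpoch (- q) q (n + m)))"

text \<open>
  The infinite product is the limit of the finite ones, coefficient by coefficient in \<open>t\<close>, each
  coefficient converging in the \<open>q\<close>-adic metric of the Laurent series. The metric of the outer
  type \<open>fps\<close> is the \<open>t\<close>-adic one, which ignores convergence of the coefficients; the
  products do not converge there.
\<close>
definition qpoch_inf :: "'a::field fls fps \<Rightarrow> 'a fls fps \<Rightarrow> 'a fls fps" where
  "qpoch_inf a q = Abs_fps (\<lambda>n. lim (\<lambda>N. fps_nth (qpoch a q N) n))"

text \<open>
  The limits above exist for the products \<open>(b t; q\<^sup>2)\<^sub>\<infinity>\<close> with \<open>b\<close> a power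
  series in \<open>q\<close>, in particular for \<open>b = 1\<close> and \<open>b = q\<close>.
\<close>

lemma tendsto_fps_to_flsI:
  fixes s :: "nat \<Rightarrow> 'a::field fps"
  assumes "\<And>N k. k < N \<Longrightarrow> fps_nth (s N) k = fps_nth L k"
  shows "(\<lambda>N. fps_to_fls (s N)) \<longlonglongrightarrow> fps_to_fls L"
proof (rule metric_LIMSEQ_I)
  fix r :: real assume r: "r > 0"
  then obtain M where M: "inverse (2 ^ M) < r"
    using real_arch_pow_inv[of r "1/2"] by (auto simp: field_simps)
  have "dist (fps_to_fls (s N)) (fps_to_fls L) < r" if "N \<ge> M" for N
  proof (cases "s N = L")
    case False
    have "subdegree (L - s N) \<ge> N"
      using False assms by (intro subdegree_geI) auto
    then have "(2::real) ^ M \<le> 2 ^ subdegree (L - s N)"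
      using that by (intro power_increasing) auto
    then have "inverse ((2::real) ^ subdegree (L - s N)) \<le> inverse (2 ^ M)"
      by (intro le_imp_inverse_le) auto
    also note M
    finally have "inverse ((2::real) ^ subdegree (s N - L)) < r"
      by (simp add: subdegree_minus_commute)
    with False show ?thesis
      by (simp add: dist_fls_def fls_subdegree_fls_to_fps flip: fps_to_fls_minus)
  qed (use r in auto)
  then show "\<exists>M. \<forall>N\<ge>M. dist (fps_to_fls (s N)) (fps_to_fls L) < r" by blast
qed

lemma qpoch_nth_convergent:
  fixes b :: "'a::field fps"
  shows "convergent (\<lambda>N. fps_nth
           (qpoch (fps_const (fps_to_fls b) * fps_X) (fps_const (fls_X ^ 2)) N) n)"
proof -
  define P where "P = (\<lambda>N. qpoch (fps_const b * fps_X) (fps_const ((fps_X::'a fps) ^ 2)) N)"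
  let ?Q = "\<lambda>N. qpoch (fps_const (fps_to_fls b) * fps_X) (fps_const ((fls_X::'a fls) ^ 2)) N"
  have PS: "fps_nth (P (Suc N)) m = fps_nth (P N) m -
      (if m = 0 then 0 else b * fps_X ^ (2 * N) * fps_nth (P N) (m - 1))" for N m
  proof -
    have "P (Suc N) = P N - fps_const (b * fps_X ^ (2 * N)) * (fps_X * P N)"
      by (simp add: P_def qpoch_def algebra_simps flip: power_mult fps_const_mult)
    then show ?thesis by (simp only: fps_sub_nth fps_mult_left_const_nth fps_X_mult_nth) auto
  qed
  have QS: "fps_nth (?Q (Suc N)) m = fps_nth (?Q N) m -
      (if m = 0 then 0 else fps_to_fls b * fls_X ^ (2 * N) * fps_nth (?Q N) (m - 1))" for N m
  proof -
    have "?Q (Suc N) = ?Q N - fps_const (fps_to_fls b * fls_X ^ (2 * N)) * (fps_X * ?Q N)"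
      by (simp add: qpoch_def algebra_simps flip: power_mult fps_const_mult)
    then show ?thesis by (simp only: fps_sub_nth fps_mult_left_const_nth fps_X_mult_nth) auto
  qed
  have PQ: "fps_nth (?Q N) m = fps_to_fls (fps_nth (P N) m)" for N m
  proof (induction N arbitrary: m)
    case 0
    then show ?case by (simp add: P_def qpoch_def)
  next
    case (Suc N)
    show ?case unfolding PS QS Suc.IH
      by (simp add: fls_times_fps_to_fls fps_to_fls_power)
  qed
  define L where "L = Abs_fps (\<lambda>k. fps_nth (fps_nth (P (Suc k)) n) k)"
  have step: "fps_nth (fps_nth (P (Suc N)) n) k = fps_nth (fps_nth (P N) n) k" if "k < N" for N k
    using that unfolding PS
    by (auto simp: mult.assoc mult.left_commute[of b] fps_X_power_mult_nth)
  have "fps_nth (fps_nth (P N) n) k = fps_nth L k" if "k < N" for N k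
    using that
  proof (induction N)
    case (Suc N)
    then show ?case using step[of k N] by (cases "k = N") (auto simp: L_def)
  qed simp
  then have "(\<lambda>N. fps_to_fls (fps_nth (P N) n)) \<longlonglongrightarrow> fps_to_fls L"
    by (rule tendsto_fps_to_flsI)
  then show ?thesis unfolding PQ convergent_def by blast
qed

text \<open>
  Division in \<open>'b fps\<close> truncates when the divisor has the larger subdegree; division by \<open>t\<close>
  as below is exact.
\<close>
lemma qsc_gf_0_nth_0: "fps_nth (qsc_gf 0 q) 0 = 1"
  by (simp add: qsc_gf_def q_super_catalan_def qfact_def qpoch_def)

lemma qsc_gf_0_division_exact:
  fixes q c :: "'b::field"
  defines "g \<equiv> qsc_gf 0 q oo (fps_const c * fps_X)"
  shows "fps_X * g dvd fps_const q * (g - 1)"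
proof -
  have "fps_nth g 0 = 1"
    by (simp add: g_def fps_compose_nth_0 qsc_gf_0_nth_0)
  then have "is_unit g"
    by simp
  moreover have "fps_X dvd g - 1"
  proof
    show "g - 1 = fps_X * fps_shift 1 (g - 1)"
      using \<open>fps_nth g 0 = 1\<close> by (intro fps_ext) (auto simp: fps_X_mult_nth)
  qed
  ultimately show ?thesis
    by (metis dvd_mult mult.commute mult_unit_dvd_iff)
qed

end

theory Submission
  imports Defs
begin

text \<open>
  Put \<open>Q = q\<^sup>2\<close>. Splitting \<open>(q;q)\<^bsub>2n\<^esub>\<close> into odd and even factors turns the coefficients of \<open>f\<^sub>0\<close> into
  \<open>(q;Q)\<^sub>n / (Q;Q)\<^sub>n\<close> and those of \<open>f\<^sub>1\<close> into \<open>(1 - q) (q;Q)\<^sub>n / (Q;Q)\<^bsub>n+1\<^esub>\<close>. The series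
  \<open>B\<^sub>a(t) = (\<Sum>n. (a;Q)\<^sub>n / (Q;Q)\<^sub>n t\<^sup>n)\<close> satisfies \<open>(1 - t) B\<^sub>a(t) = (1 - a t) B\<^sub>a(Q t)\<close>, and
  equations \<open>F(t) = (1 - a t) F(Q t)\<close> determine \<open>F\<close> up to its constant term. Comparing such
  equations yields the q-binomial theorem \<open>B\<^sub>a(t) (t;Q)\<^sub>\<infinity> = (a t;Q)\<^sub>\<infinity>\<close> and
  \<open>B\<^sub>a(t/a) B\<^bsub>1/a\<^esub>(t) = 1\<close>. For \<open>a = q\<close> the second identity says \<open>1 / f\<^sub>0(t/q) = B\<^bsub>1/q\<^esub>(t)\<close>, and
  \<open>(1/q;Q)\<^bsub>n+1\<^esub> = (1 - 1/q) (q;Q)\<^sub>n\<close> gives \<open>q (1 - B\<^bsub>1/q\<^esub>(t)) = t f\<^sub>1(t)\<close>.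
\<close>

section \<open>Finite q-Pochhammer symbols\<close>

lemma qpoch_0 [simp]: "qpoch a q 0 = 1"
  by (simp add: qpoch_def)

lemma qpoch_Suc: "qpoch a q (Suc n) = qpoch a q n * (1 - a * q ^ n)"
  by (simp add: qpoch_def)

lemma qpoch_Suc_shift: "qpoch a q (Suc n) = (1 - a) * qpoch (a * q) q n"
  unfolding qpoch_def by (subst prod.lessThan_Suc_shift) (simp add: mult.assoc)

lemma qpoch_diag_nonzero:
  fixes q :: "'b::idom"
  assumes "\<And>n. n > 0 \<Longrightarrow> q ^ n \<noteq> 1"
  shows "qpoch q q n \<noteq> 0"
  using assms[of "Suc _"] by (auto simp: qpoch_def)

lemma qpoch_mult_minus:
  "qpoch a q n * qpoch (- a) q n = qpoch (a ^ 2) (q ^ 2) n"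
proof (induction n)
  case (Suc n)
  have "qpoch a q (Suc n) * qpoch (- a) q (Suc n) =
      (qpoch a q n * qpoch (- a) q n) * ((1 - a * q ^ n) * (1 + a * q ^ n))"
    by (simp add: qpoch_Suc algebra_simps)
  also have "(1 - a * q ^ n) * (1 + a * q ^ n) = 1 - a ^ 2 * (q ^ 2) ^ n"
    by (simp add: power2_eq_square power_mult_distrib algebra_simps)
  finally show ?case
    by (simp add: Suc.IH qpoch_Suc)
qed simp

text \<open>The factors of even index form the first product, those of odd index the second.\<close>

lemma qpoch_double:
  "qpoch a q (2 * n) = qpoch a (q ^ 2) n * qpoch (a * q) (q ^ 2) n"
proof (induction n)
  case (Suc n)
  then show ?case
    by (simp add: qpoch_Suc power_mult) (simp only: mult_ac)
qed simp

lemma qfact_conv_qpoch: "qfact q n = qpoch q q n / (1 - q) ^ n"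
proof -
  have "qfact q n = (\<Prod>k<n. (1 - q ^ Suc k) / (1 - q))"
    unfolding qfact_def qint_def
    by (rule prod.reindex_bij_witness[of _ Suc "\<lambda>k. k - 1"]) auto
  then show ?thesis
    by (simp add: qpoch_def prod_dividef)
qed

section \<open>The q-binomial series\<close>

definition qbinomial_series :: "'b::field \<Rightarrow> 'b \<Rightarrow> 'b fps" where
  "qbinomial_series a q = Abs_fps (\<lambda>n. qpoch a q n / qpoch q q n)"

lemma fps_compose_linear_commute:
  fixes f :: "'b::comm_ring_1 fps"
  shows "(f oo (fps_const c * fps_X)) oo (fps_const d * fps_X) =
    (f oo (fps_const d * fps_X)) oo (fps_const c * fps_X)"
  by (rule fps_ext) (simp add: mult.left_commute)

lemma one_minus_linear_compose_linear:
  fixes a :: "'b::comm_ring_1"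
  shows "(1 - fps_const a * fps_X) oo (fps_const c * fps_X) = 1 - fps_const (a * c) * fps_X"
  by (rule fps_ext) (auto simp: mult.commute[of c a] le_Suc_eq)

text \<open>At degree k + 1 this is the recursion (1 - q^(k+1)) c_(k+1) = (1 - a q^k) c_k, which the
  quotients c_n = (a;q)_n / (q;q)_n satisfy.\<close>

lemma qbinomial_series_q_shift:
  fixes a q :: "'b::field"
  assumes "\<And>n. n > 0 \<Longrightarrow> q ^ n \<noteq> 1"
  shows "(1 - fps_X) * qbinomial_series a q =
    (1 - fps_const a * fps_X) * (qbinomial_series a q oo (fps_const q * fps_X))"
proof (rule fps_ext)
  fix n
  show "fps_nth ((1 - fps_X) * qbinomial_series a q) n =
    fps_nth ((1 - fps_const a * fps_X) * (qbinomial_series a q oo (fps_const q * fps_X))) n"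
  proof (cases n)
    case (Suc k)
    have "qpoch q q k \<noteq> 0" "1 - q * q ^ k \<noteq> 0"
      using qpoch_diag_nonzero[of q k] assms[of "Suc k"] assms by auto
    then show ?thesis
      by (simp add: Suc qbinomial_series_def left_diff_distrib mult.assoc qpoch_Suc)
        (simp add: field_simps)
  qed (simp add: qbinomial_series_def)
qed

text \<open>Each coefficient determines the next, since the factor 1 - q^(n+1) in front of the
  latter does not vanish.\<close>

lemma fps_q_shift_equation_unique:
  fixes a q :: "'b::field"
  assumes q: "\<And>n. n > 0 \<Longrightarrow> q ^ n \<noteq> 1"
    and F: "F = (1 - fps_const a * fps_X) * (F oo (fps_const q * fps_X))"
    and G: "G = (1 - fps_const a * fps_X) * (G oo (fps_const q * fps_X))"
    and nth_0: "fps_nth F 0 = fps_nth G 0"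
  shows "F = G"
proof (rule fps_ext)
  have rec: "(1 - q ^ Suc n) * fps_nth H (Suc n) = - a * q ^ n * fps_nth H n"
    if "H = (1 - fps_const a * fps_X) * (H oo (fps_const q * fps_X))" for H n
  proof -
    have "fps_nth H (Suc n) = q ^ Suc n * fps_nth H (Suc n) - a * (q ^ n * fps_nth H n)"
      using arg_cong[OF that, of "\<lambda>f. fps_nth f (Suc n)"]
      by (simp add: left_diff_distrib mult.assoc)
    then show ?thesis
      by (simp add: algebra_simps)
  qed
  show "fps_nth F n = fps_nth G n" for n
  proof (induction n)
    case (Suc n)
    have "(1 - q ^ Suc n) * fps_nth F (Suc n) = (1 - q ^ Suc n) * fps_nth G (Suc n)"
      unfolding rec[OF F] rec[OF G] Suc.IH ..
    then show ?case
      using q[of "Suc n"] by simp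
  qed (rule nth_0)
qed

text \<open>Putting t/a into the equation for B_a gives (1 - t/a) G(t) = (1 - t) G(q t), which is
  the equation for B_(1/a) with its linear factors swapped. They cancel in the product, which is
  therefore invariant under t -> q t and hence constant.\<close>

lemma qbinomial_series_inverse:
  fixes a q :: "'b::field"
  assumes q: "\<And>n. n > 0 \<Longrightarrow> q ^ n \<noteq> 1" and a: "a \<noteq> 0"
  shows "(qbinomial_series a q oo (fps_const (1 / a) * fps_X)) * qbinomial_series (1 / a) q = 1"
    (is "?G * ?H = 1")
proof -
  let ?s = "\<lambda>c. fps_const c * fps_X :: 'b fps"
  have "((1 - fps_X) * qbinomial_series a q) oo ?s (1 / a) =
      ((1 - ?s a) * (qbinomial_series a q oo ?s q)) oo ?s (1 / a)"
    by (simp only: qbinomial_series_q_shift[OF q])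
  then have G: "(1 - ?s (1 / a)) * ?G = (1 - fps_X) * (?G oo ?s q)"
    using a one_minus_linear_compose_linear[of 1 "1 / a"]
    by (simp add: fps_compose_mult_distrib one_minus_linear_compose_linear
        fps_compose_linear_commute[of _ q])
  have H: "(1 - fps_X) * ?H = (1 - ?s (1 / a)) * (?H oo ?s q)"
    by (rule qbinomial_series_q_shift[OF q])
  have "((1 - ?s (1 / a)) * (1 - fps_X)) * (?G * ?H) =
      ((1 - ?s (1 / a)) * ?G) * ((1 - fps_X) * ?H)"
    by (simp only: mult_ac)
  also have "\<dots> = ((1 - ?s (1 / a)) * (1 - fps_X)) * ((?G * ?H) oo ?s q)"
    unfolding G H by (simp add: fps_compose_mult_distrib mult_ac)
  finally have eq: "((1 - ?s (1 / a)) * (1 - fps_X)) * (?G * ?H) =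
      ((1 - ?s (1 / a)) * (1 - fps_X)) * ((?G * ?H) oo ?s q)" .
  have "fps_nth ((1 - ?s (1 / a)) * (1 - fps_X)) 0 \<noteq> 0"
    by simp
  then have "(1 - ?s (1 / a)) * (1 - fps_X) \<noteq> 0"
    by fastforce
  with eq have GH: "?G * ?H = (?G * ?H) oo ?s q"
    by (simp only: mult_cancel_left simp_thms)
  show ?thesis
  \<comment> \<open>Invariance is the shift equation with coefficient 0, and the series 1 solves it
    too.\<close>
  proof (rule fps_q_shift_equation_unique[OF q])
    show "?G * ?H = (1 - ?s 0) * ((?G * ?H) oo ?s q)"
      using GH by (simp only: fps_const_0_eq_0 mult_zero_left diff_zero mult_1_left)
    show "1 = (1 - ?s 0) * (1 oo ?s q)"
      by simp
    show "fps_nth (?G * ?H) 0 = fps_nth 1 0"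
      by (simp add: qbinomial_series_def)
  qed
qed

section \<open>The infinite products\<close>

text \<open>Subdegrees add under multiplication over a field, so multiplying by c rescales every
  distance by the same factor.\<close>

lemma dist_fls_mult_left:
  fixes c x y :: "'a::field fls"
  assumes "c \<noteq> 0"
  shows "dist (c * x) (c * y) = 2 powr (- of_int (fls_subdegree c)) * dist x y"
proof -
  \<comment> \<open>A real exponent covers subdegrees of either sign in one formula.\<close>
  have dist_powr: "dist u v = 2 powr (- of_int (fls_subdegree (u - v)))"
    if "u \<noteq> v" for u v :: "'a fls"
    using that by (auto simp: dist_fls_def powr_minus simp flip: powr_realpow)
  show ?thesis
  proof (cases "x = y")
    case False
    have "fls_subdegree (c * x - c * y) = fls_subdegree c + fls_subdegree (x - y)"
      using assms False by (simp flip: right_diff_distrib)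
    then show ?thesis
      using assms False by (simp add: dist_powr powr_add[symmetric])
  qed simp
qed

lemma tendsto_fls_mult_left:
  fixes c :: "'a::field fls"
  assumes "(f \<longlongrightarrow> l) F"
  shows "((\<lambda>x. c * f x) \<longlongrightarrow> c * l) F"
proof (cases "c = 0")
  case False
  have "((\<lambda>x. 2 powr (- of_int (fls_subdegree c)) * dist (f x) l) \<longlongrightarrow>
      2 powr (- of_int (fls_subdegree c)) * 0) F"
    using assms by (intro tendsto_intros) (simp flip: tendsto_dist_iff)
  then show ?thesis
    using False by (simp add: tendsto_dist_iff[of "\<lambda>x. c * f x"] dist_fls_mult_left)
qed simp

text \<open>The metric depends only on differences, so a detour through \<open>l - g x\<close>
  separates the two errors. With \<open>tendsto_fls_mult_left\<close> this allows limits in linear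
  recursions between coefficients.\<close>

lemma tendsto_fls_diff:
  fixes f g :: "'b \<Rightarrow> 'a::ab_group_add fls"
  assumes f: "(f \<longlongrightarrow> l) F" and g: "(g \<longlongrightarrow> m) F"
  shows "((\<lambda>x. f x - g x) \<longlongrightarrow> l - m) F"
proof -
  have le: "dist (f x - g x) (l - m) \<le> dist (f x) l + dist (g x) m" for x
  proof -
    have "dist (f x - g x) (l - m) \<le> dist (f x - g x) (l - g x) + dist (l - g x) (l - m)"
      by (rule dist_triangle)
    also have "dist (f x - g x) (l - g x) = dist (f x) l"
      by (simp add: dist_fls_def)
    also have "dist (l - g x) (l - m) = dist m (g x)"
      by (simp add: dist_fls_def)
    finally show ?thesis
      by (simp add: dist_commute)
  qed
  have lim: "((\<lambda>x. dist (f x) l + dist (g x) m) \<longlongrightarrow> 0) F"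
    using f g by (intro tendsto_add_zero) (simp_all only: tendsto_dist_iff[symmetric])
  have "((\<lambda>x. dist (f x - g x) (l - m)) \<longlongrightarrow> 0) F"
    by (rule tendsto_sandwich[OF _ _ tendsto_const lim]) (simp_all add: le)
  then show ?thesis
    by (simp only: tendsto_dist_iff[symmetric])
qed

text \<open>Replacing t by q t moves every factor to the next index, so only the first factor has to
  be supplied.\<close>

lemma qpoch_linear_q_shift:
  fixes b q :: "'b::idom"
  shows "qpoch (fps_const b * fps_X) (fps_const q) (Suc N) =
    (1 - fps_const b * fps_X) *
      (qpoch (fps_const b * fps_X) (fps_const q) N oo (fps_const q * fps_X))"
proof -
  have "qpoch (fps_const b * fps_X) (fps_const q) N oo (fps_const q * fps_X) =
      qpoch (fps_const b * fps_X * fps_const q) (fps_const q) N"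
  proof (induction N)
    case (Suc N)
    have "(1 - fps_const b * fps_X * fps_const q ^ N) oo (fps_const q * fps_X) =
        1 - fps_const b * fps_X * fps_const q * fps_const q ^ N"
      by (simp add: fps_compose_sub_distrib fps_compose_mult_distrib)
    then show ?case
      by (simp add: qpoch_Suc fps_compose_mult_distrib Suc.IH)
  qed simp
  then show ?thesis
    by (simp add: qpoch_Suc_shift)
qed

context
  fixes b :: "'a::field fps" and P :: "'a fls fps"
  defines "P \<equiv> qpoch_inf (fps_const (fps_to_fls b) * fps_X) (fps_const (fls_X ^ 2))"
begin

text \<open>\<open>lim\<close> is informative only under convergence, which is known here because b
  is a power series in q.\<close>

lemma qpoch_inf_nth_tendsto:
  "(\<lambda>N. fps_nth (qpoch (fps_const (fps_to_fls b) * fps_X) (fps_const (fls_X ^ 2)) N) n)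
    \<longlonglongrightarrow> fps_nth P n"
  using qpoch_nth_convergent[of b n]
  by (simp add: P_def qpoch_inf_def convergent_LIMSEQ_iff)

lemma qpoch_inf_nth_0: "fps_nth P 0 = 1"
proof -
  have "fps_nth (qpoch (fps_const (fps_to_fls b) * fps_X) (fps_const (fls_X ^ 2)) N) 0 = 1" for N
    by (induction N) (simp_all add: qpoch_Suc)
  then show ?thesis
    using qpoch_inf_nth_tendsto[of 0] by (simp add: LIMSEQ_const_iff)
qed

text \<open>This is the limit of \<open>qpoch_linear_q_shift\<close> in each coefficient; the N + 1
  factors on one side and the N on the other lead to the same limit.\<close>

lemma qpoch_inf_q_shift:
  "P = (1 - fps_const (fps_to_fls b) * fps_X) * (P oo (fps_const (fls_X ^ 2) * fps_X))"
proof (rule fps_ext)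
  fix n
  define c where "c = fps_to_fls b"
  define Q where "Q = (fls_X ^ 2 :: 'a fls)"
  define p where "p = (\<lambda>N. fps_nth (qpoch (fps_const c * fps_X) (fps_const Q) N))"
  have lim: "(\<lambda>N. p N k) \<longlonglongrightarrow> fps_nth P k" for k
    unfolding p_def c_def Q_def by (rule qpoch_inf_nth_tendsto)
  show "fps_nth P n =
    fps_nth ((1 - fps_const (fps_to_fls b) * fps_X) *
      (P oo (fps_const (fls_X ^ 2) * fps_X))) n"
  proof (cases n)
    case (Suc k)
    have "p (Suc N) n = Q ^ n * p N n - (c * Q ^ k) * p N k" for N
      unfolding p_def qpoch_linear_q_shift
      by (simp add: Suc left_diff_distrib mult.assoc)
    then have "(\<lambda>N. p (Suc N) n) \<longlonglongrightarrow> Q ^ n * fps_nth P n - (c * Q ^ k) * fps_nth P k"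
      by (simp only:) (intro tendsto_fls_diff tendsto_fls_mult_left lim)
    with LIMSEQ_Suc[OF lim[of n]]
    have "fps_nth P n = Q ^ n * fps_nth P n - (c * Q ^ k) * fps_nth P k"
      by (rule LIMSEQ_unique)
    then show ?thesis
      by (simp add: Suc left_diff_distrib mult.assoc c_def Q_def)
  qed simp
qed

end

lemma fls_X_power_neq_1:
  assumes "n > 0"
  shows "(fls_X :: 'a::field fls) ^ n \<noteq> 1"
proof
  assume "(fls_X :: 'a fls) ^ n = 1"
  then have "fls_subdegree ((fls_X :: 'a fls) ^ n) = fls_subdegree (1 :: 'a fls)"
    by simp
  with assms show False
    by simp
qed

text \<open>The factor 1 - t contributed by the equation for (t;Q)_inf is absorbed by the equation
  for B_b, so the product obeys the equation for (b t;Q)_inf. All constant terms are 1.\<close>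

theorem qbinomial_theorem:
  fixes b :: "'a::field fps"
  defines "Q \<equiv> fls_X ^ 2"
  shows "qbinomial_series (fps_to_fls b) Q * qpoch_inf fps_X (fps_const Q) =
    qpoch_inf (fps_const (fps_to_fls b) * fps_X) (fps_const Q)"
    (is "?B * ?P = ?R")
proof (rule fps_q_shift_equation_unique)
  let ?s = "fps_const Q * fps_X"
  show Q: "Q ^ n \<noteq> 1" if "n > 0" for n
    using that fls_X_power_neq_1[of "2 * n"] by (simp add: Q_def power_mult)
  have P: "?P = (1 - fps_X) * (?P oo ?s)"
    using qpoch_inf_q_shift[of "1 :: 'a fps"] by (simp add: Q_def)
  have "?B * ?P = ((1 - fps_X) * ?B) * (?P oo ?s)"
    by (subst P) (simp only: mult_ac)
  also have "\<dots> = (1 - fps_const (fps_to_fls b) * fps_X) * ((?B oo ?s) * (?P oo ?s))"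
    by (simp only: qbinomial_series_q_shift[OF Q] mult.assoc)
  also have "(?B oo ?s) * (?P oo ?s) = (?B * ?P) oo ?s"
    by (simp add: fps_compose_mult_distrib)
  finally show "?B * ?P = (1 - fps_const (fps_to_fls b) * fps_X) * ((?B * ?P) oo ?s)" .
  show "?R = (1 - fps_const (fps_to_fls b) * fps_X) * (?R oo ?s)"
    unfolding Q_def by (rule qpoch_inf_q_shift)
  show "fps_nth (?B * ?P) 0 = fps_nth ?R 0"
    using qpoch_inf_nth_0[of b] qpoch_inf_nth_0[of "1 :: 'a fps"]
    by (simp add: Q_def qbinomial_series_def)
qed

section \<open>The generating functions\<close>

context
  fixes q :: "'b::field"
  assumes q: "\<And>n. n > 0 \<Longrightarrow> q ^ n \<noteq> 1"
begin

lemma q_neq_1: "q \<noteq> 1"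
  using q[of 1] by simp

lemma q_square_not_root_of_unity: "n > 0 \<Longrightarrow> (q ^ 2) ^ n \<noteq> 1"
  using q[of "2 * n"] by (simp add: power_mult)

text \<open>The powers of 1 - q cancel, and (q;q)_n (-q;q)_n = (Q;Q)_n; its square in the
  denominator loses one factor to the even part of (q;q)_(2n).\<close>

lemma qsc_gf_0_eq_qbinomial_series: "qsc_gf 0 q = qbinomial_series q (q ^ 2)"
proof (rule fps_ext)
  fix n
  have nz: "qpoch q q n \<noteq> 0" "qpoch (- q) q n \<noteq> 0" "qpoch (q ^ 2) (q ^ 2) n \<noteq> 0"
    using qpoch_diag_nonzero[OF q_square_not_root_of_unity, of n] qpoch_mult_minus[of q q n]
    by auto
  have "fps_nth (qsc_gf 0 q) n = qpoch q q (2 * n) / (qpoch q q n * qpoch (- q) q n) ^ 2"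
    using nz q_neq_1
    by (simp add: qsc_gf_def q_super_catalan_def qfact_conv_qpoch divide_simps
        power2_eq_square power_mult mult_ac)
  also have "\<dots> = qpoch q (q ^ 2) n / qpoch (q ^ 2) (q ^ 2) n"
    unfolding qpoch_mult_minus qpoch_double using nz by (simp add: power2_eq_square)
  finally show "fps_nth (qsc_gf 0 q) n = fps_nth (qbinomial_series q (q ^ 2)) n"
    by (simp add: qbinomial_series_def)
qed

text \<open>The factorial [2]! = 1 + q cancels the prefactor 1 / (-q;q)_1. The factor 1 - q remains
  because [n]! [n+1]! carries one more power of it than [2n]!.\<close>

lemma qsc_gf_1_nth:
  "fps_nth (qsc_gf 1 q) n = (1 - q) * qpoch q (q ^ 2) n / qpoch (q ^ 2) (q ^ 2) (Suc n)"
proof -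
  have nz: "qpoch q q m \<noteq> 0" "qpoch (- q) q m \<noteq> 0" "qpoch (q ^ 2) (q ^ 2) m \<noteq> 0" for m
    using qpoch_diag_nonzero[OF q_square_not_root_of_unity, of m] qpoch_mult_minus[of q q m]
    by auto
  have q2: "1 + q \<noteq> 0" "1 - q \<noteq> 0"
    using nz(2)[of 1] q_neq_1 by (simp_all add: qpoch_Suc)
  have qfact_2: "qfact q 2 = 1 + q"
    using q2 by (simp add: qfact_def qint_def numeral_2_eq_2 field_simps)
  have qfact_1: "qfact q (Suc 0) = 1"
    using q2 by (simp add: qfact_def qint_def)
  have "fps_nth (qsc_gf 1 q) n = (1 - q) * qpoch q q (2 * n) /
      ((qpoch q q n * qpoch (- q) q n) * (qpoch q q (Suc n) * qpoch (- q) q (Suc n)))"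
    using nz[of n] nz[of "Suc n"] q2
    by (simp add: qsc_gf_def q_super_catalan_def qfact_2 qfact_1 qpoch_Suc[of _ _ 0])
       (simp add: qfact_conv_qpoch divide_simps power2_eq_square power_mult mult_ac)
  also have "\<dots> = (1 - q) * qpoch q (q ^ 2) n / qpoch (q ^ 2) (q ^ 2) (Suc n)"
    unfolding qpoch_mult_minus qpoch_double using nz by (simp add: power2_eq_square)
  finally show ?thesis .
qed

lemma fps_X_mult_qsc_gf_1:
  assumes "q \<noteq> 0"
  shows "fps_X * qsc_gf 1 q = fps_const q * (1 - qbinomial_series (1 / q) (q ^ 2))"
proof (rule fps_ext)
  fix n
  show "fps_nth (fps_X * qsc_gf 1 q) n =
    fps_nth (fps_const q * (1 - qbinomial_series (1 / q) (q ^ 2))) n"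
  proof (cases n)
    case (Suc k)
    have "1 / q * q ^ 2 = q"
      using assms by (simp add: power2_eq_square)
    then have shift: "qpoch (1 / q) (q ^ 2) (Suc k) = (1 - 1 / q) * qpoch q (q ^ 2) k"
      using qpoch_Suc_shift[of "1 / q" "q ^ 2" k] by simp
    have "fps_nth (fps_X * qsc_gf 1 q) n =
        (1 - q) * qpoch q (q ^ 2) k / qpoch (q ^ 2) (q ^ 2) (Suc k)"
      unfolding Suc fps_X_mult_nth by (simp add: qsc_gf_1_nth[simplified])
    also have "1 - q = - q * (1 - 1 / q)"
      using assms by (simp add: field_simps)
    also have "- q * (1 - 1 / q) * qpoch q (q ^ 2) k / qpoch (q ^ 2) (q ^ 2) (Suc k) =
        fps_nth (fps_const q * (1 - qbinomial_series (1 / q) (q ^ 2))) n"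
      unfolding Suc fps_mult_left_const_nth fps_sub_nth qbinomial_series_def fps_nth_Abs_fps shift
      by simp
    finally show ?thesis .
  qed (simp add: qbinomial_series_def)
qed

end

theorem proposition8:
  fixes q :: "'a::field_char_0 fls" and f0 f1 g :: "'a fls fps"
  defines "q \<equiv> fls_X"
    and "f0 \<equiv> qsc_gf 0 q"
    and "f1 \<equiv> qsc_gf 1 q"
    and "g \<equiv> f0 oo (fps_const (1 / q) * fps_X)"
  shows "f0 = qpoch_inf (fps_const q * fps_X) (fps_const (q ^ 2)) /
              qpoch_inf fps_X (fps_const (q ^ 2))
       \<and> f1 = (fps_const q * (g - 1)) / (fps_X * g)"
proof
  have q: "q ^ n \<noteq> 1" if "n > 0" for n
    using that by (simp add: q_def fls_X_power_neq_1)
  have q0: "q \<noteq> 0"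
    by (simp add: q_def)
  have f0_eq: "f0 = qbinomial_series q (q ^ 2)"
    unfolding f0_def by (rule qsc_gf_0_eq_qbinomial_series[OF q])
  let ?P = "qpoch_inf fps_X (fps_const (q ^ 2))"
  have "?P \<noteq> 0"
    using qpoch_inf_nth_0[of "1 :: 'a fps"] by (auto simp: q_def)
  moreover have "f0 * ?P = qpoch_inf (fps_const q * fps_X) (fps_const (q ^ 2))"
    using qbinomial_theorem[of "fps_X :: 'a fps"]
    by (simp add: f0_eq q_def)
  ultimately show "f0 = qpoch_inf (fps_const q * fps_X) (fps_const (q ^ 2)) / ?P"
    by (metis nonzero_mult_div_cancel_right)
  let ?h = "qbinomial_series (1 / q) (q ^ 2)"
  have gh: "g * ?h = 1"
    unfolding g_def f0_eq
    by (rule qbinomial_series_inverse[OF q_square_not_root_of_unity[OF q] q0])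
  \<comment> \<open>Multiplying out first shows that the division is exact; since \<open>?h\<close>
    inverts g, g (1 - \<open>?h\<close>) = g - 1.\<close>
  have "f1 * (fps_X * g) = (fps_X * f1) * g"
    by (simp only: mult_ac)
  also have "fps_X * f1 = fps_const q * (1 - ?h)"
    unfolding f1_def by (rule fps_X_mult_qsc_gf_1[OF q q0])
  also have "\<dots> * g = fps_const q * (g - g * ?h)"
    by (simp add: algebra_simps)
  finally have "f1 * (fps_X * g) = fps_const q * (g - 1)"
    unfolding gh .
  moreover have "fps_X * g \<noteq> 0"
    using gh by auto
  ultimately show "f1 = (fps_const q * (g - 1)) / (fps_X * g)"
    by (metis nonzero_mult_div_cancel_right)
qed

end
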